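(* Let $p\in\mathbb N$ and let $(Y_1,\boldsymbol X_1),(Y_2,\boldsymbol X_2),\ldots$ be iid random pairs with values in $\mathbb R_{>0}\times\mathbb R^p$ following the Fréchet regression model with true parameter $\boldsymbol\eta_\dagger=(\alpha_\dagger,\boldsymbol\beta_\dagger)\in \mathrm H:=\mathbb R_{>0}\times\mathbb R^p$. Assume that $\mathsf P[\boldsymbol a^\top\boldsymbol X_1=0]<1$ for all $\boldsymbol a\in\mathbb R^p\setminus\{\boldsymbol 0\}$. Let $M_n(\boldsymbol\eta)=\frac1n\sum_{i=1}^n m(\boldsymbol\eta\mid Y_i,\boldsymbol X_i)$ for $\boldsymbol\eta\in\mathrm H$. Then, for any sequence of $\mathrm H$-valued estimators $\tilde{\boldsymbol\eta}_n$ of $\boldsymbol\eta_\dagger$ (where $\tilde{\boldsymbol\eta}_n$ is based on the first $n$ pairs) such that $$M_n(\tilde{\boldsymbol\eta}_n)\ \ge\ M_n(\boldsymbol\eta_\dagger)-o_{\mathsf P}(1)\qquad (n\to\infty),$$ we have $\tilde{\boldsymbol\eta}_n\to\boldsymbol\eta_\dagger$ in probability as $n\to\infty$.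
   Context: Vectors in $\mathbb R^p$ are column vectors. Fréchet regression model with parameter $\boldsymbol\eta=(\alpha,\boldsymbol\beta)\in\mathrm H$: for all $\boldsymbol x\in\mathbb R^p$, the conditional distribution of $Y_i$ given $\boldsymbol X_i=\boldsymbol x$ satisfies $$\mathsf P(Y_i\le y\mid\boldsymbol X_i=\boldsymbol x)=\exp\left[-\left(\frac{y}{\exp(\boldsymbol\beta^\top\boldsymbol x)}\right)^{-\alpha}\right],\qquad y>0 .$$ Objective function: with $g(t)=t-\exp(t)$, $$m(\boldsymbol\eta\mid y,\boldsymbol x)=\ln\alpha+g\big(\alpha(\boldsymbol\beta^\top\boldsymbol x-\ln y)\big),\qquad \boldsymbol\eta=(\alpha,\boldsymbol\beta)\in\mathrm H,\ y>0,\ \boldsymbol x\in\mathbb R^p,$$ which is the logarithm of the conditional density of $Y$ given $\boldsymbol X=\boldsymbol x$ with respect to the measure $y^{-1}dy$ on $\mathbb R_{>0}$. The notation $o_{\mathsf P}(1)$ stands for a sequence of random variables converging to $0$ in probability. *)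

theory Defs
  imports "HOL-Probability.Probability"
begin

definition frechet_params :: "(real \<times> (real ^ 'p)) set" where
  "frechet_params = {0<..} \<times> UNIV"

text \<open>\<open>K\<close> is a regular version of the conditional distribution of \<open>Y\<close> given \<open>X\<close> under \<open>M\<close>:
  \<open>K x\<close> is the law of \<open>Y\<close> given \<open>X = x\<close>. The measurability condition says that
  \<open>K\<close> is a Markov kernel.\<close>

definition regular_cond_distr ::
  "'w measure \<Rightarrow> ('w \<Rightarrow> real) \<Rightarrow> ('w \<Rightarrow> real ^ 'p) \<Rightarrow> (real ^ 'p \<Rightarrow> real measure) \<Rightarrow> bool" where
  "regular_cond_distr M Y X K \<longleftrightarrow>
     K \<in> borel \<rightarrow>\<^sub>M prob_algebra borel \<and>
     (\<forall>A \<in> sets borel. \<forall>B \<in> sets borel.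
        measure M {\<omega> \<in> space M. Y \<omega> \<in> A \<and> X \<omega> \<in> B} =
        (LINT x:B|distr M borel X. measure (K x) A))"

text \<open>Conditional distributions are determined only up to null sets of the law of \<open>X\<close>, so
  the formula for all \<open>x\<close> is read as a statement about some regular version.\<close>

definition frechet_model ::
  "'w measure \<Rightarrow> real \<times> (real ^ 'p) \<Rightarrow> ('w \<Rightarrow> real) \<Rightarrow> ('w \<Rightarrow> real ^ 'p) \<Rightarrow> bool" where
  "frechet_model M \<eta> Y X \<longleftrightarrow>
     (\<exists>K. regular_cond_distr M Y X K \<and>
        (\<forall>x. \<forall>y>0. measure (K x) {..y} =
           exp (- ((y / exp (snd \<eta> \<bullet> x)) powr (- fst \<eta>)))))"

definition frechet_g :: "real \<Rightarrow> real" where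
  "frechet_g t = t - exp t"

definition frechet_m :: "real \<times> (real ^ 'p) \<Rightarrow> real \<times> (real ^ 'p) \<Rightarrow> real" where
  "frechet_m \<eta> z =
     ln (fst \<eta>) + frechet_g (fst \<eta> * (snd \<eta> \<bullet> snd z - ln (fst z)))"

definition frechet_M ::
  "(nat \<Rightarrow> 'w \<Rightarrow> real \<times> (real ^ 'p)) \<Rightarrow> nat \<Rightarrow> real \<times> (real ^ 'p) \<Rightarrow> 'w \<Rightarrow> real" where
  "frechet_M Z n \<eta> \<omega> = (1 / real n) * (\<Sum>i=1..n. frechet_m \<eta> (Z i \<omega>))"

text \<open>The random element \<open>est\<close> is a measurable function of the sample \<open>Z 1, \<dots>, Z n\<close>.\<close>

definition estimator_from ::
  "'w measure \<Rightarrow> (nat \<Rightarrow> 'w \<Rightarrow> 'z::topological_space) \<Rightarrow> nat \<Rightarrow> ('w \<Rightarrow> 't::topological_space) \<Rightarrow> bool"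
  where
  "estimator_from M Z n est \<longleftrightarrow>
     (\<exists>T \<in> borel_measurable (Pi\<^sub>M {1..n} (\<lambda>_. borel)).
        \<forall>\<omega> \<in> space M. est \<omega> = T (\<lambda>i\<in>{1..n}. Z i \<omega>))"

text \<open>Only meaningful for measurable \<open>V n\<close>, since \<^const>\<open>measure\<close> vanishes on non-measurable
  sets.\<close>

definition tendsto_in_prob ::
  "'w measure \<Rightarrow> (nat \<Rightarrow> 'w \<Rightarrow> 'b::metric_space) \<Rightarrow> 'b \<Rightarrow> bool" where
  "tendsto_in_prob M V c \<longleftrightarrow>
     (\<forall>\<epsilon>>0. (\<lambda>n. measure M {\<omega> \<in> space M. dist (V n \<omega>) c > \<epsilon>}) \<longlonglongrightarrow> 0)"

end

theory Submission
  imports Defs "HOL-Real_Asymp.Real_Asymp"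
begin

text \<open>Put \<open>W = \<alpha>\<^sub>0 (\<beta>\<^sub>0 \<bullet> X - ln Y)\<close>. Under the model, \<open>W\<close> is independent of \<open>X\<close> with density
  \<open>exp (frechet_g w)\<close>, and in the coordinates \<open>\<theta> = (\<alpha> / \<alpha>\<^sub>0, \<alpha> (\<beta> - \<beta>\<^sub>0))\<close> the difference of objective
  functions is \<open>L \<theta> = ln r + frechet_g (r W + c \<bullet> X) - frechet_g W\<close> with \<open>\<theta> = (r, c)\<close>, which is
  concave in \<open>\<theta>\<close> and vanishes at \<open>(1, 0)\<close>. By concavity, a near-maximizer far from \<open>(1, 0)\<close> forces an
  average of \<open>L\<close> to be almost nonnegative at some point of a small sphere around \<open>(1, 0)\<close>. Since \<open>L\<close> is
  a log-likelihood ratio, \<open>E (exp (L \<theta> / 2)) < 1\<close> for \<open>\<theta> \<noteq> (1, 0)\<close>, and this survives replacing \<open>L\<close> by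
  its envelope over a small ball, so Chernoff's bound makes this event exponentially unlikely for
  each ball of a finite cover of the sphere.\<close>

section \<open>The function \<open>frechet_g\<close> and its unique maximum\<close>

lemma frechet_g_le: "frechet_g t \<le> -1"
  unfolding frechet_g_def using exp_ge_add_one_self[of t] by linarith

lemma frechet_g_eq_iff: "frechet_g t = -1 \<longleftrightarrow> t = 0"
proof
  assume "frechet_g t = -1"
  then have "exp t = 1 + t" by (simp add: frechet_g_def)
  \<comment> \<open>In terms of \<open>x = exp t\<close> the equation reads
    \<open>ln x = x - 1\<close>, whose only positive solution is \<open>x = 1\<close>.\<close>
  then show "t = 0" by (metis exp_eq_one_iff ln_exp ln_eq_minus_one add_diff_cancel_left' exp_gt_zero exp_zero)
qed (simp add: frechet_g_def)

lemma continuous_on_frechet_g [continuous_intros]: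
  "continuous_on S f \<Longrightarrow> continuous_on S (\<lambda>x. frechet_g (f x))"
  unfolding frechet_g_def by (intro continuous_intros)

lemma measurable_frechet_g [measurable]: "frechet_g \<in> borel_measurable borel"
  unfolding frechet_g_def[abs_def] by measurable

section \<open>The Gumbel law and integrals against it\<close>

text \<open>This is the Gumbel law for minima, the law of the logarithm of a unit exponential
  variable.\<close>

definition gumbel :: "real measure" where
  "gumbel = density lborel (\<lambda>w. ennreal (exp (frechet_g w)))"

lemma sets_gumbel [simp, measurable_cong]: "sets gumbel = sets borel"
  by (simp add: gumbel_def)

lemma space_gumbel [simp]: "space gumbel = UNIV"
  by (simp add: gumbel_def)

lemma emeasure_gumbel_atLeast: "emeasure gumbel {a..} = ennreal (exp (- exp a))"
proof -
  have "((\<lambda>w::real. - exp (- exp w)) \<longlongrightarrow> 0) at_top"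
    by real_asymp
  \<comment> \<open>An antiderivative of \<open>exp (frechet_g w)\<close> is
    \<open>- exp (- exp w)\<close>, which vanishes at infinity.\<close>
  then have "(\<integral>\<^sup>+w. ennreal (exp (frechet_g w)) * indicator {a..} w \<partial>lborel) = 0 - (- exp (- exp a))"
    by (intro nn_integral_FTC_atLeast)
       (auto intro!: derivative_eq_intros simp: frechet_g_def exp_diff exp_minus field_simps)
  then show ?thesis
    by (simp add: gumbel_def emeasure_density)
qed

interpretation gumbel: prob_space gumbel
proof
  have "(\<lambda>n. emeasure gumbel {- real n..}) \<longlonglongrightarrow> emeasure gumbel (\<Union>n. {- real n..})"
    by (intro Lim_emeasure_incseq) (auto simp: incseq_def)
  moreover have "(\<Union>n. {- real n..}) = UNIV"
    by (auto, metis real_arch_simple minus_le_iff)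
  moreover have "(\<lambda>n. exp (- exp (- real n))) \<longlonglongrightarrow> 1"
    by real_asymp
  then have "(\<lambda>n. emeasure gumbel {- real n..}) \<longlonglongrightarrow> ennreal 1"
    unfolding emeasure_gumbel_atLeast by (rule tendsto_ennrealI)
  ultimately show "emeasure gumbel (space gumbel) = 1"
    using LIMSEQ_unique by fastforce
qed

lemma measure_gumbel_atLeast: "measure gumbel {a..} = exp (- exp a)"
  by (simp add: measure_def emeasure_gumbel_atLeast)

lemma nn_integral_frechet_g: "(\<integral>\<^sup>+w. ennreal (exp (frechet_g w)) \<partial>lborel) = 1"
  using gumbel.emeasure_space_1 by (simp add: gumbel_def emeasure_density)

text \<open>The term \<open>ln r\<close> is the logarithm of a Jacobian: the integrand is the
  density of \<open>(W - t) / r\<close> when \<open>W\<close> has law \<open>gumbel\<close>.\<close>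

lemma nn_integral_frechet_g_affine:
  assumes "r > 0"
  shows "(\<integral>\<^sup>+w. ennreal (exp (ln r + frechet_g (r * w + t))) \<partial>lborel) = 1"
proof -
  have "(\<integral>\<^sup>+w. ennreal (exp (ln r + frechet_g (r * w + t))) \<partial>lborel)
      = (\<integral>\<^sup>+w. ennreal r * ennreal (exp (frechet_g (t + r * w))) \<partial>lborel)"
    using assms by (simp add: exp_add ennreal_mult add.commute)
  also have "\<dots> = ennreal r * (\<integral>\<^sup>+w. ennreal (exp (frechet_g (t + r * w))) \<partial>lborel)"
    by (intro nn_integral_cmult) measurable
  also have "\<dots> = 1"
    using nn_integral_real_affine[of "\<lambda>w. ennreal (exp (frechet_g w))" r t] assms
    by (simp add: nn_integral_frechet_g)
  finally show ?thesis .
qed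

text \<open>The Gumbel density cancels the subtracted \<open>frechet_g w\<close>. This turns
  integrals of likelihood ratios into Lebesgue integrals of densities.\<close>

lemma nn_integral_gumbel_exp:
  assumes [measurable]: "f \<in> borel_measurable borel"
  shows "(\<integral>\<^sup>+w. ennreal (exp (f w - frechet_g w)) \<partial>gumbel) = (\<integral>\<^sup>+w. ennreal (exp (f w)) \<partial>lborel)"
  unfolding gumbel_def
  by (subst nn_integral_density)
     (auto simp flip: ennreal_mult exp_add intro!: nn_integral_cong)

text \<open>Completing the square gives \<open>frechet_g w / 2 \<le> frechet_g (w / 2) + 1 / 2\<close>, so a multiple of
  a rescaled Gumbel density dominates.\<close>

lemma integrable_exp_half_frechet_g: "integrable gumbel (\<lambda>w. exp (- frechet_g w / 2))"
proof (rule integrableI_nonneg)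
  have *: "frechet_g w / 2 \<le> 1 / 2 + ln 2 + (ln (1/2) + frechet_g ((1/2) * w + 0))" for w
  proof -
    have "0 \<le> (exp (w / 2) - 1)\<^sup>2" by simp
    also have "\<dots> = exp w - 2 * exp (w / 2) + 1"
      by (simp add: power2_eq_square algebra_simps flip: exp_add)
    finally show ?thesis by (simp add: frechet_g_def ln_div)
  qed
  have "(\<integral>\<^sup>+w. ennreal (exp (- frechet_g w / 2)) \<partial>gumbel) = (\<integral>\<^sup>+w. ennreal (exp (frechet_g w / 2)) \<partial>lborel)"
    using nn_integral_gumbel_exp[of "\<lambda>w. frechet_g w / 2"] by (simp add: field_simps)
  also have "\<dots> \<le> (\<integral>\<^sup>+w. ennreal (exp (1 / 2 + ln 2)) * ennreal (exp (ln (1/2) + frechet_g ((1/2) * w + 0))) \<partial>lborel)"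
    using * by (intro nn_integral_mono) (simp flip: ennreal_mult exp_add)
  also have "\<dots> = ennreal (exp (1 / 2 + ln 2)) * 1"
    using nn_integral_frechet_g_affine[of "1/2" 0] by (subst nn_integral_cmult) auto
  also have "\<dots> < \<infinity>" by simp
  finally show "(\<integral>\<^sup>+w. ennreal (exp (- frechet_g w / 2)) \<partial>gumbel) < \<infinity>" .
qed auto

text \<open>Both sides attain their maxima, which are \<open>ln r - 1\<close> and \<open>-1\<close>; comparing them forces \<open>r = 1\<close>.\<close>

lemma frechet_g_affine_eq_imp:
  assumes r: "r > 0" and eq: "\<And>w. ln r + frechet_g (r * w + t) = frechet_g w"
  shows "r = 1 \<and> t = 0"
proof -
  have "ln r - 1 = frechet_g (- t / r)"
    using eq[of "- t / r"] r by (simp add: frechet_g_def)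
  then have "ln r \<le> 0"
    using frechet_g_le[of "- t / r"] by linarith
  moreover have "ln r \<ge> 0"
    using eq[of 0] frechet_g_le[of t] by (simp add: frechet_g_def)
  ultimately have "r = 1" using r by simp
  then show ?thesis
    using eq[of 0] frechet_g_eq_iff[of t] by (simp add: frechet_g_def)
qed

text \<open>The Gumbel density is positive everywhere, so its null sets are Lebesgue null. The open
  set where \<open>f\<close> differs from 0 is then negligible, hence empty.\<close>

lemma AE_gumbel_continuous_imp:
  fixes f :: "real \<Rightarrow> real"
  assumes ae: "AE w in gumbel. f w = 0" and cont: "continuous_on UNIV f"
  shows "f w = 0"
proof (rule ccontr)
  assume w: "f w \<noteq> 0"
  have [measurable]: "f \<in> borel_measurable borel"
    using cont by (rule borel_measurable_continuous_onI)
  have "AE w in lborel. f w = 0"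
    using ae unfolding gumbel_def by (subst (asm) AE_density) auto
  then have "{w. f w \<noteq> 0} \<in> null_sets lborel"
    by (subst (asm) AE_iff_null) auto
  then have "negligible {w. f w \<noteq> 0}"
    by (simp add: negligible_iff_null_sets null_sets_completionI)
  moreover have "open {w. f w \<noteq> 0}"
    using open_Collect_neq[OF cont continuous_on_const[of UNIV 0]] .
  ultimately show False
    using open_not_negligible w by blast
qed

section \<open>The Frechet model as an image of the Gumbel law\<close>

text \<open>For \<open>y > 0\<close> the event \<open>exp (s - w / a) \<le> y\<close> is the
  half-line \<open>w \<ge> a * (s - ln y)\<close>, whose Gumbel probability is exactly the
  prescribed value of the distribution function.\<close>

lemma frechet_model_kernel:
  fixes K :: "real measure"
  assumes "sets K = sets borel" "prob_space K" and a: "a > 0"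
    and cdf: "\<And>y. y > 0 \<Longrightarrow> measure K {..y} = exp (- ((y / exp s) powr (- a)))"
  shows "K = distr gumbel borel (\<lambda>w. exp (s - w / a))"
proof (rule cdf_unique)
  interpret K: prob_space K by fact
  show "real_distribution K"
    using assms(1) by unfold_locales (auto dest: sets_eq_imp_space_eq)
  show "real_distribution (distr gumbel borel (\<lambda>w. exp (s - w / a)))"
    by (intro gumbel.real_distribution_distr) auto
  have eq: "measure K {..y} = exp (- exp (a * (s - ln y)))" if "y > 0" for y
  proof -
    have "(y / exp s) powr (- a) = exp (a * (s - ln y))"
      using that by (simp add: powr_def ln_div algebra_simps)
    then show ?thesis using cdf[OF that] by simp
  qed
  show "cdf K = cdf (distr gumbel borel (\<lambda>w. exp (s - w / a)))"
  proof
    fix y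
    have "measure (distr gumbel borel (\<lambda>w. exp (s - w / a))) {..y} = measure gumbel {w. exp (s - w / a) \<le> y}"
      by (subst measure_distr) (auto intro!: arg_cong[where f="measure gumbel"])
    also have "\<dots> = measure K {..y}"
    proof (cases "y > 0")
      case True
      then have "exp (s - w / a) \<le> y \<longleftrightarrow> a * (s - ln y) \<le> w" for w
        using a by (subst ln_ge_iff[symmetric]) (auto simp: field_simps)
      then have "{w. exp (s - w / a) \<le> y} = {a * (s - ln y)..}" by auto
      then show ?thesis using eq[OF True] by (simp add: measure_gumbel_atLeast)
    next
      case False
      \<comment> \<open>The hypothesis prescribes values only at positive arguments. Monotonicity
        compares \<open>y \<le> 0\<close> with the positive points \<open>exp (s - n / a)\<close>,
        where the distribution function tends to 0.\<close>
      have "measure K {..y} \<le> exp (- exp (real n))" for n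
      proof -
        have "measure K {..y} \<le> measure K {..exp (s - real n / a)}"
          using False assms(1) by (intro K.finite_measure_mono) (auto intro: order_trans[of _ 0])
        then show ?thesis using eq[of "exp (s - real n / a)"] a by simp
      qed
      moreover have "(\<lambda>n. exp (- exp (real n))) \<longlonglongrightarrow> 0" by real_asymp
      ultimately have "measure K {..y} \<le> 0"
        by (intro LIMSEQ_le_const) auto
      moreover have "y < exp t" for t
        using False exp_gt_zero[of t] by linarith
      then have "{w. exp (s - w / a) \<le> y} = {}" by (auto simp: not_le)
      ultimately show ?thesis by (simp add: measure_le_0_iff)
    qed
    finally show "cdf K y = cdf (distr gumbel borel (\<lambda>w. exp (s - w / a))) y"
      by (simp add: cdf_def)
  qed
qed

text \<open>It suffices to compare the two laws on rectangles \<open>A \<times> B\<close>. There the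
  left side is an integral of the kernel over \<open>B\<close>, and since each \<open>K x\<close> is
  an image of \<open>gumbel\<close>, this is the product measure of the preimage computed by slices
  at fixed \<open>x\<close>.\<close>

lemma frechet_model_distr:
  fixes X :: "'w \<Rightarrow> real ^ 'p"
  assumes "prob_space M" and [measurable]: "Y \<in> borel_measurable M" "X \<in> borel_measurable M"
    and model: "frechet_model M (a, b) Y X" and a: "a > 0"
  shows "distr M borel (\<lambda>\<omega>. (Y \<omega>, X \<omega>)) =
    distr (gumbel \<Otimes>\<^sub>M distr M borel X) borel (\<lambda>(w, x). (exp (b \<bullet> x - w / a), x))"
proof -
  interpret prob_space M by fact
  define \<mu> where "\<mu> = distr M borel X"
  have sets_mu [simp, measurable_cong]: "sets \<mu> = sets borel" and space_mu [simp]: "space \<mu> = UNIV"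
    by (auto simp: \<mu>_def)
  interpret mu: prob_space \<mu> unfolding \<mu>_def by (rule prob_space_distr) fact
  interpret P: pair_prob_space gumbel \<mu> by unfold_locales
  obtain K where reg: "regular_cond_distr M Y X K"
    and K_cdf: "\<And>x y. y > 0 \<Longrightarrow> measure (K x) {..y} = exp (- ((y / exp (b \<bullet> x)) powr (- a)))"
    using model unfolding frechet_model_def fst_conv snd_conv by blast
  have K_meas: "K \<in> borel \<rightarrow>\<^sub>M prob_algebra borel"
    and K: "\<And>A B. A \<in> sets borel \<Longrightarrow> B \<in> sets borel \<Longrightarrow>
        measure M {\<omega> \<in> space M. Y \<omega> \<in> A \<and> X \<omega> \<in> B} = (LINT x:B|\<mu>. measure (K x) A)"
    using reg unfolding regular_cond_distr_def \<mu>_def by blast+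
  have K_prob: "sets (K x) = sets borel" "prob_space (K x)" for x
    using measurable_space[OF K_meas, of x] by (auto simp: space_prob_algebra)
  have K_eq: "K x = distr gumbel borel (\<lambda>w. exp (b \<bullet> x - w / a))" for x
    by (intro frechet_model_kernel K_prob a K_cdf)
  let ?T = "\<lambda>(w, x). (exp (b \<bullet> x - w / a), x)"
  let ?E = "{A \<times> B | A B. A \<in> sets borel \<and> B \<in> sets borel} :: (real \<times> (real ^ 'p)) set set"
  have T [measurable]: "?T \<in> borel_measurable (gumbel \<Otimes>\<^sub>M \<mu>)"
    unfolding borel_prod[symmetric] by measurable
  have sets_eq: "sets (borel :: (real \<times> (real ^ 'p)) measure) = sigma_sets UNIV ?E"
    unfolding borel_prod[symmetric] by (simp add: sets_pair_measure)
  have "distr M borel (\<lambda>\<omega>. (Y \<omega>, X \<omega>)) = distr (gumbel \<Otimes>\<^sub>M \<mu>) borel ?T"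
  proof (rule measure_eqI_generator_eq[where \<Omega>=UNIV and E="?E" and A="\<lambda>_. UNIV"])
    show "Int_stable ?E" by (rule Int_stable_pair_measure_generator)
    have "UNIV \<in> ?E"
      by (rule CollectI, intro exI[of _ UNIV]) simp
    then show "range (\<lambda>_::nat. UNIV) \<subseteq> ?E"
      by (simp only: image_subset_iff ball_UNIV simp_thms)
    show "sets (distr M borel (\<lambda>\<omega>. (Y \<omega>, X \<omega>))) = sigma_sets UNIV ?E"
      "sets (distr (gumbel \<Otimes>\<^sub>M \<mu>) borel ?T) = sigma_sets UNIV ?E"
      unfolding sets_distr by (fact sets_eq)+
    show "emeasure (distr M borel (\<lambda>\<omega>. (Y \<omega>, X \<omega>))) UNIV \<noteq> \<infinity>"
      by (subst emeasure_distr) (auto simp: emeasure_eq_measure)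
    fix C assume "C \<in> ?E"
    then obtain A B where C: "C = A \<times> B" and [measurable]: "A \<in> sets borel" "B \<in> sets borel"
      by blast
    have [measurable]: "A \<times> B \<in> sets borel"
      unfolding borel_prod[symmetric] by measurable
    have "emeasure (distr M borel (\<lambda>\<omega>. (Y \<omega>, X \<omega>))) C = emeasure M {\<omega> \<in> space M. Y \<omega> \<in> A \<and> X \<omega> \<in> B}"
      unfolding C by (subst emeasure_distr) (auto intro!: arg_cong[where f="emeasure M"])
    also have "\<dots> = ennreal (\<integral>x. indicator B x * measure (K x) A \<partial>\<mu>)"
      using K[of A B] by (simp add: emeasure_eq_measure set_lebesgue_integral_def)
    also have "\<dots> = (\<integral>\<^sup>+x. ennreal (indicator B x * measure (K x) A) \<partial>\<mu>)"
    proof (rule nn_integral_eq_integral[symmetric])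
      have [measurable]: "(\<lambda>x. measure (K x) A) \<in> borel_measurable \<mu>"
        using measurable_compose[OF K_meas measurable_measure_prob_algebra[of A]] by simp
      show "integrable \<mu> (\<lambda>x. indicator B x * measure (K x) A)"
        by (rule mu.integrable_const_bound[of _ 1])
           (auto simp: indicator_def prob_space.prob_le_1[OF K_prob(2)])
    qed auto
    also have "\<dots> = (\<integral>\<^sup>+x. emeasure gumbel ((\<lambda>w. (w, x)) -` (?T -` C \<inter> space (gumbel \<Otimes>\<^sub>M \<mu>))) \<partial>\<mu>)"
    proof (rule nn_integral_cong)
      fix x
      have "ennreal (measure (K x) A) = emeasure gumbel {w. exp (b \<bullet> x - w / a) \<in> A}"
        unfolding K_eq by (subst measure_distr) (auto simp: gumbel.emeasure_eq_measure vimage_def)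
      then show "ennreal (indicator B x * measure (K x) A) =
          emeasure gumbel ((\<lambda>w. (w, x)) -` (?T -` C \<inter> space (gumbel \<Otimes>\<^sub>M \<mu>)))"
        by (cases "x \<in> B") (auto simp: C space_pair_measure vimage_def)
    qed
    also have "\<dots> = emeasure (distr (gumbel \<Otimes>\<^sub>M \<mu>) borel ?T) C"
      unfolding C
      by (subst emeasure_distr, measurable, subst P.emeasure_pair_measure_alt2) measurable
    finally show "emeasure (distr M borel (\<lambda>\<omega>. (Y \<omega>, X \<omega>))) C = emeasure (distr (gumbel \<Otimes>\<^sub>M \<mu>) borel ?T) C" .
  qed simp_all
  then show ?thesis unfolding \<mu>_def .
qed

text \<open>The map \<open>?S\<close> inverts \<open>?T\<close>, so applying it to the previous
  representation leaves the product measure. The product form expresses the independence of the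
  standardized error and the covariate.\<close>

lemma frechet_model_gumbel:
  fixes X :: "'w \<Rightarrow> real ^ 'p"
  assumes "prob_space M" and [measurable]: "Y \<in> borel_measurable M" "X \<in> borel_measurable M"
    and "frechet_model M (a, b) Y X" and a: "a > 0"
  shows "distr M borel (\<lambda>\<omega>. (a * (b \<bullet> X \<omega> - ln (Y \<omega>)), X \<omega>)) = gumbel \<Otimes>\<^sub>M distr M borel X"
proof -
  let ?P = "gumbel \<Otimes>\<^sub>M distr M borel X"
  let ?S = "\<lambda>(y, x :: real ^ 'p). (a * (b \<bullet> x - ln y), x)"
  let ?T = "\<lambda>(w, x :: real ^ 'p). (exp (b \<bullet> x - w / a), x)"
  have S: "?S \<in> borel_measurable borel" and T: "?T \<in> borel_measurable ?P"
    and YX: "(\<lambda>\<omega>. (Y \<omega>, X \<omega>)) \<in> borel_measurable M"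
    unfolding borel_prod[symmetric] by measurable
  have "distr M borel (\<lambda>\<omega>. (a * (b \<bullet> X \<omega> - ln (Y \<omega>)), X \<omega>)) =
      distr (distr M borel (\<lambda>\<omega>. (Y \<omega>, X \<omega>))) borel ?S"
    by (subst distr_distr[OF S YX]) (simp add: comp_def)
  also have "\<dots> = distr ?P borel (?S \<circ> ?T)"
    unfolding frechet_model_distr[OF assms] by (rule distr_distr[OF S T])
  also have "?S \<circ> ?T = (\<lambda>u. u)"
    using a by (auto simp: fun_eq_iff)
  also have "distr ?P borel (\<lambda>u. u) = ?P"
    by (intro distr_id2) (simp add: borel_prod[symmetric] cong: sets_pair_measure_cong)
  finally show ?thesis .
qed

section \<open>An exponential tail bound for iid sums\<close>

text \<open>Chernoff's argument with exponent 1: by independence the exponential of the sum has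
  expectation \<open>\<rho> ^ n\<close>, and Markov's inequality at level
  \<open>exp (- \<epsilon> * n)\<close> gives the geometric bound
  \<open>(\<rho> * exp \<epsilon>) ^ n\<close>.\<close>

lemma (in prob_space) prob_sum_ge_tendsto_0:
  fixes V :: "nat \<Rightarrow> 'a \<Rightarrow> real"
  assumes indep: "indep_vars (\<lambda>_. borel) V {1..}"
    and ident: "\<And>i. i \<ge> 1 \<Longrightarrow> distr M borel (V i) = distr M borel (V 1)"
    and int: "integrable M (\<lambda>\<omega>. exp (V 1 \<omega>))"
    and less: "expectation (\<lambda>\<omega>. exp (V 1 \<omega>)) < 1"
  shows "\<exists>\<epsilon>>0. (\<lambda>n. prob {\<omega> \<in> space M. (\<Sum>i=1..n. V i \<omega>) \<ge> - \<epsilon> * real n}) \<longlonglongrightarrow> 0"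
proof -
  define \<rho> where "\<rho> = expectation (\<lambda>\<omega>. exp (V 1 \<omega>))"
  have \<rho>: "0 \<le> \<rho>" "\<rho> < 1" unfolding \<rho>_def using less by (auto intro!: integral_nonneg_AE)
  \<comment> \<open>This choice makes
    \<open>\<rho> * exp \<epsilon> = 2 * \<rho> / (1 + \<rho>)\<close>, which is below 1 because
    \<open>\<rho> < 1\<close>.\<close>
  define \<epsilon> where "\<epsilon> = - ln ((1 + \<rho>) / 2)"
  have \<epsilon>: "\<epsilon> > 0" "exp \<epsilon> = 2 / (1 + \<rho>)"
    using \<rho> by (auto simp: \<epsilon>_def exp_minus ln_less_zero field_simps)
  have V [measurable]: "V i \<in> borel_measurable M" if "i \<ge> 1" for i
    using indep that by (auto simp: indep_vars_def)
  have int_i: "integrable M (\<lambda>\<omega>. exp (V i \<omega>))" and exp_i: "expectation (\<lambda>\<omega>. exp (V i \<omega>)) = \<rho>"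
    if i: "i \<ge> 1" for i
  proof -
    have 1: "integrable (distr M borel (V 1)) exp"
      using int by (subst integrable_distr_eq) (auto intro: V)
    show "integrable M (\<lambda>\<omega>. exp (V i \<omega>))"
      using 1 i unfolding ident[OF i, symmetric] by (subst (asm) integrable_distr_eq) (auto intro: V)
    have "expectation (\<lambda>\<omega>. exp (V i \<omega>)) = integral\<^sup>L (distr M borel (V i)) exp"
      using i by (subst integral_distr) auto
    also have "\<dots> = \<rho>"
      unfolding ident[OF i] \<rho>_def by (subst integral_distr) auto
    finally show "expectation (\<lambda>\<omega>. exp (V i \<omega>)) = \<rho>" .
  qed
  have bound: "prob {\<omega> \<in> space M. (\<Sum>i=1..n. V i \<omega>) \<ge> - \<epsilon> * real n} \<le> (\<rho> * exp \<epsilon>) ^ n" for n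
  proof -
    have ind: "indep_vars (\<lambda>_. borel) (\<lambda>i \<omega>. exp (V i \<omega>)) {1..n}"
      by (rule indep_vars_compose2[where Y="\<lambda>_. exp", OF indep_vars_subset[OF indep]]) auto
    have I: "integrable M (\<lambda>\<omega>. \<Prod>i=1..n. exp (V i \<omega>))"
      using int_i by (intro indep_vars_integrable ind) auto
    have E: "expectation (\<lambda>\<omega>. \<Prod>i=1..n. exp (V i \<omega>)) = \<rho> ^ n"
      using int_i by (subst indep_vars_lebesgue_integral[OF _ ind]) (auto simp: exp_i)
    have "{\<omega> \<in> space M. (\<Sum>i=1..n. V i \<omega>) \<ge> - \<epsilon> * real n} =
        {\<omega> \<in> space M. (\<Prod>i=1..n. exp (V i \<omega>)) \<ge> exp (- \<epsilon> * real n)}"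
      by (simp add: exp_sum[symmetric])
    also have "prob \<dots> \<le> \<rho> ^ n / exp (- \<epsilon> * real n)"
      using integral_Markov_inequality_measure[OF I sets.empty_sets, of "exp (- \<epsilon> * real n)", unfolded E]
      by (simp add: prod_nonneg)
    also have "\<dots> = (\<rho> * exp \<epsilon>) ^ n"
      by (simp add: power_mult_distrib exp_minus field_simps flip: exp_of_nat_mult)
    finally show ?thesis .
  qed
  have "(\<lambda>n. (\<rho> * exp \<epsilon>) ^ n) \<longlonglongrightarrow> 0"
    using \<rho> by (intro LIMSEQ_power_zero) (simp add: \<epsilon> field_simps)
  then have "(\<lambda>n. prob {\<omega> \<in> space M. (\<Sum>i=1..n. V i \<omega>) \<ge> - \<epsilon> * real n}) \<longlonglongrightarrow> 0"
    by (rule tendsto_sandwich[OF _ _ tendsto_const, rotated 2]) (use bound in auto)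
  then show ?thesis using \<epsilon> by blast
qed

section \<open>The log-likelihood ratio: concavity, identifiability and local envelopes\<close>

definition loglik_ratio :: "real \<times> (real ^ 'p) \<Rightarrow> real \<times> (real ^ 'p) \<Rightarrow> real" where
  "loglik_ratio \<theta> u =
     ln (fst \<theta>) + frechet_g (fst \<theta> * fst u + snd \<theta> \<bullet> snd u) - frechet_g (fst u)"

text \<open>This is concavity along the segment from \<open>(1, 0)\<close>, where the ratio
  vanishes, so only one endpoint contributes. It combines concavity of \<open>ln\<close> with
  convexity of \<open>exp\<close>, whose argument is affine in the parameter.\<close>

lemma loglik_ratio_concave:
  assumes r: "fst \<theta> > 0" and t: "0 \<le> t" "t \<le> 1"
  shows "t * loglik_ratio \<theta> u \<le> loglik_ratio ((1 - t) *\<^sub>R (1, 0) + t *\<^sub>R \<theta>) u"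
proof -
  obtain r c where \<theta>: "\<theta> = (r, c)" by force
  obtain w x where u: "u = (w, x)" by force
  have ln: "t * ln r \<le> ln ((1 - t) + t * r)"
  proof -
    have "concave_on {0<..} (ln :: real \<Rightarrow> real)" by (rule ln_concave)
    from concave_onD[OF this, of t 1 r] show ?thesis using t r by (simp add: \<theta>)
  qed
  have exp: "exp ((1 - t) * w + t * (r * w + c \<bullet> x)) \<le> (1 - t) * exp w + t * exp (r * w + c \<bullet> x)"
  proof -
    have "convex_on UNIV (exp :: real \<Rightarrow> real)" by (rule exp_convex)
    from convex_onD[OF this, of t w "r * w + c \<bullet> x"] show ?thesis using t by simp
  qed
  \<comment> \<open>The parameter \<open>(1, 0)\<close> has linear argument \<open>w\<close>, so the
    point on the segment has the convex combination of \<open>w\<close> and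
    \<open>r * w + c \<bullet> x\<close>.\<close>
  have arg: "((1 - t) + t * r) * w + t * (c \<bullet> x) = (1 - t) * w + t * (r * w + c \<bullet> x)"
    by (simp add: algebra_simps)
  have "loglik_ratio ((1 - t) *\<^sub>R (1, 0) + t *\<^sub>R \<theta>) u =
      ln ((1 - t) + t * r) + frechet_g ((1 - t) * w + t * (r * w + c \<bullet> x)) - frechet_g w"
    by (simp add: loglik_ratio_def \<theta> u arg)
  moreover have "t * loglik_ratio \<theta> u =
      t * ln r + t * frechet_g (r * w + c \<bullet> x) - t * frechet_g w"
    by (simp add: loglik_ratio_def \<theta> u algebra_simps)
  moreover have "t * frechet_g (r * w + c \<bullet> x) - t * frechet_g w
      \<le> frechet_g ((1 - t) * w + t * (r * w + c \<bullet> x)) - frechet_g w"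
    using exp unfolding frechet_g_def by (simp add: algebra_simps)
  ultimately show ?thesis using ln by linarith
qed

text \<open>The model in standardized coordinates: \<open>\<mu>\<close> is the law of the covariate,
  \<open>gumbel \<Otimes>\<^sub>M \<mu>\<close> the law of one standardized observation, and
  \<open>(1, 0)\<close> the true parameter.\<close>

locale gumbel_regression =
  mu: prob_space \<mu> for \<mu> :: "(real ^ 'p) measure" +
  assumes sets_mu [simp, measurable_cong]: "sets \<mu> = sets borel"
    and nondegenerate: "\<And>a. a \<noteq> 0 \<Longrightarrow> measure \<mu> {x. a \<bullet> x = 0} < 1"
begin

sublocale P: pair_prob_space gumbel \<mu> ..

lemma space_mu [simp]: "space \<mu> = UNIV"
  using sets_eq_imp_space_eq[OF sets_mu] by simp

lemma measurable_loglik_ratio [measurable]: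
  "loglik_ratio \<theta> \<in> borel_measurable (gumbel \<Otimes>\<^sub>M \<mu>)"
  unfolding loglik_ratio_def[abs_def] by measurable

text \<open>Already for each fixed \<open>x\<close> the integral over \<open>w\<close> is that of an
  affinely transformed Gumbel density, hence 1.\<close>

lemma nn_integral_exp_loglik_ratio:
  assumes "fst \<theta> > 0"
  shows "(\<integral>\<^sup>+u. ennreal (exp (loglik_ratio \<theta> u)) \<partial>(gumbel \<Otimes>\<^sub>M \<mu>)) = 1"
proof -
  have "(\<integral>\<^sup>+w. ennreal (exp (loglik_ratio \<theta> (w, x))) \<partial>gumbel) = 1" for x
    using nn_integral_gumbel_exp[of "\<lambda>w. ln (fst \<theta>) + frechet_g (fst \<theta> * w + snd \<theta> \<bullet> x)"]
      nn_integral_frechet_g_affine[OF assms, of "snd \<theta> \<bullet> x"]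
    by (simp add: loglik_ratio_def)
  then have "(\<integral>\<^sup>+x. \<integral>\<^sup>+w. ennreal (exp (loglik_ratio \<theta> (w, x))) \<partial>gumbel \<partial>\<mu>) = 1"
    using mu.emeasure_space_1 by simp
  then show ?thesis
    by (subst (asm) P.nn_integral_snd) auto
qed

text \<open>Identifiability. After exchanging the almost-everywhere quantifiers, continuity yields
  the equation for every \<open>w\<close> at almost every \<open>x\<close>. This forces
  \<open>fst \<theta> = 1\<close> and \<open>snd \<theta> \<bullet> x = 0\<close> for almost all
  \<open>x\<close>, and nondegeneracy of \<open>\<mu>\<close> gives
  \<open>snd \<theta> = 0\<close>.\<close>

lemma loglik_ratio_AE_zero_imp:
  assumes r: "fst \<theta> > 0" and ae: "AE u in gumbel \<Otimes>\<^sub>M \<mu>. loglik_ratio \<theta> u = 0"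
  shows "\<theta> = (1, 0)"
proof -
  have "AE w in gumbel. AE x in \<mu>. loglik_ratio \<theta> (w, x) = 0"
    using P.AE_pair[OF ae] .
  moreover have "{u \<in> space (gumbel \<Otimes>\<^sub>M \<mu>). loglik_ratio \<theta> (fst u, snd u) = 0} \<in> sets (gumbel \<Otimes>\<^sub>M \<mu>)"
    unfolding prod.collapse by measurable
  ultimately have "AE x in \<mu>. AE w in gumbel. loglik_ratio \<theta> (w, x) = 0"
    using P.AE_commute[of "\<lambda>w x. loglik_ratio \<theta> (w, x) = 0"] by blast
  then have "AE x in \<mu>. fst \<theta> = 1 \<and> snd \<theta> \<bullet> x = 0"
  proof eventually_elim
    case (elim x)
    have "loglik_ratio \<theta> (w, x) = 0" for w
      by (rule AE_gumbel_continuous_imp[OF elim]) (auto simp: loglik_ratio_def intro!: continuous_intros)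
    then show ?case
      by (intro frechet_g_affine_eq_imp[OF r]) (simp add: loglik_ratio_def)
  qed
  then have "fst \<theta> = 1" and *: "AE x in \<mu>. snd \<theta> \<bullet> x = 0"
    by (auto simp: mu.AE_const)
  moreover have "snd \<theta> = 0"
  proof (rule ccontr)
    assume "snd \<theta> \<noteq> 0"
    then have "measure \<mu> {x. snd \<theta> \<bullet> x = 0} < 1" by (rule nondegenerate)
    moreover have "measure \<mu> {x \<in> space \<mu>. snd \<theta> \<bullet> x = 0} = 1"
      using * by (subst mu.prob_Collect_eq_1) auto
    ultimately show False by simp
  qed
  ultimately show ?thesis by (simp add: prod_eq_iff)
qed

text \<open>The integral is a Hellinger affinity. Pointwise
  \<open>exp (L / 2) \<le> (1 + exp L) / 2\<close>, where the gap is half a square and the right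
  side integrates to 1. Equality of the integrals would make the square vanish almost everywhere,
  against identifiability.\<close>

lemma integral_exp_half_loglik_ratio_less_1:
  assumes r: "fst \<theta> > 0" and ne: "\<theta> \<noteq> (1, 0)"
  shows "(\<integral>u. exp (loglik_ratio \<theta> u / 2) \<partial>(gumbel \<Otimes>\<^sub>M \<mu>)) < 1"
proof -
  let ?P = "gumbel \<Otimes>\<^sub>M \<mu>" and ?L = "loglik_ratio \<theta>"
  have int: "integrable ?P (\<lambda>u. exp (?L u))"
    by (rule integrableI_nonneg) (auto simp: nn_integral_exp_loglik_ratio[OF r])
  have E: "(\<integral>u. exp (?L u) \<partial>?P) = 1"
    using nn_integral_exp_loglik_ratio[OF r] by (subst integral_eq_nn_integral) auto
  have square: "(1 + exp (?L u)) / 2 - exp (?L u / 2) = (exp (?L u / 2) - 1)\<^sup>2 / 2" for u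
    by (simp add: power2_eq_square algebra_simps diff_divide_distrib add_divide_distrib flip: exp_add)
  have le: "exp (?L u / 2) \<le> (1 + exp (?L u)) / 2" for u
    using square[of u] zero_le_power2[of "exp (?L u / 2) - 1"] by linarith
  have int': "integrable ?P (\<lambda>u. (1 + exp (?L u)) / 2)"
    using int by auto
  have int_half: "integrable ?P (\<lambda>u. exp (?L u / 2))"
    by (rule Bochner_Integration.integrable_bound[OF int']) (use le in \<open>auto simp: abs_of_pos add_pos_pos\<close>)
  have E': "(\<integral>u. (1 + exp (?L u)) / 2 \<partial>?P) = 1"
    using int E P.prob_space by simp
  have "(\<integral>u. exp (?L u / 2) \<partial>?P) \<le> 1"
    using integral_mono[OF int_half int' le] E' by simp
  moreover have "(\<integral>u. exp (?L u / 2) \<partial>?P) \<noteq> 1"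
  proof
    assume "(\<integral>u. exp (?L u / 2) \<partial>?P) = 1"
    then have "AE u in ?P. exp (?L u / 2) = (1 + exp (?L u)) / 2"
      using le E' by (intro integral_ineq_eq_0_then_AE int_half int') auto
    then have "AE u in ?P. ?L u = 0"
    proof eventually_elim
      case (elim u)
      then have "(exp (?L u / 2) - 1)\<^sup>2 / 2 = 0" using square[of u] by linarith
      then show ?case by simp
    qed
    then show False using loglik_ratio_AE_zero_imp[OF r] ne by blast
  qed
  ultimately show ?thesis by simp
qed

text \<open>Since \<open>frechet_g\<close> is at most \<open>-1\<close> and concave, replacing \<open>s\<close> by a point at distance at most
  \<open>\<delta>\<close> gives at most \<open>min (-1) (s + \<delta> - exp (s - \<delta>))\<close>. The resulting envelope is integrable
  without any moment assumption on \<open>\<mu>\<close>.\<close>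

lemma loglik_ratio_local_envelope:
  assumes r: "fst \<theta> > 0" and ne: "\<theta> \<noteq> (1, 0)"
  obtains \<rho> h where "\<rho> > 0" "h \<in> borel_measurable (borel \<Otimes>\<^sub>M borel)"
    "\<And>\<theta>' u. dist \<theta>' \<theta> \<le> \<rho> \<Longrightarrow> fst \<theta>' > 0 \<Longrightarrow> loglik_ratio \<theta>' u \<le> h u"
    "integrable (gumbel \<Otimes>\<^sub>M \<mu>) (\<lambda>u. exp (h u / 2))"
    "(\<integral>u. exp (h u / 2) \<partial>(gumbel \<Otimes>\<^sub>M \<mu>)) < 1"
proof -
  let ?P = "gumbel \<Otimes>\<^sub>M \<mu>"
  define s where "s u = fst \<theta> * fst u + snd \<theta> \<bullet> snd u" for u :: "real \<times> (real ^ 'p)"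
  define q where "q u = \<bar>fst u\<bar> + norm (snd u)" for u :: "real \<times> (real ^ 'p)"
  define \<rho> where "\<rho> k = 1 / real (Suc k)" for k
  define h where "h k u = ln (fst \<theta> + \<rho> k) + min (- 1) (s u + \<rho> k * q u - exp (s u - \<rho> k * q u))
      - frechet_g (fst u)" for k u
  have \<rho>: "0 < \<rho> k" "\<rho> k \<le> 1" for k by (auto simp: \<rho>_def)
  have \<rho>_lim: "\<rho> \<longlonglongrightarrow> 0" unfolding \<rho>_def[abs_def] by (rule LIMSEQ_inverse_real_of_nat[unfolded inverse_eq_divide])
  have h_meas [measurable]: "h k \<in> borel_measurable (borel \<Otimes>\<^sub>M borel)" for k
    unfolding h_def[abs_def] s_def[abs_def] q_def[abs_def] by measurable
  have h_meas' [measurable]: "h k \<in> borel_measurable ?P" for k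
    using h_meas[of k] by (simp cong: measurable_cong_sets sets_pair_measure_cong)
  have envelope: "loglik_ratio \<theta>' u \<le> h k u" if d: "dist \<theta>' \<theta> \<le> \<rho> k" and r': "fst \<theta>' > 0" for \<theta>' u k
  proof -
    define s' where "s' = fst \<theta>' * fst u + snd \<theta>' \<bullet> snd u"
    have d1: "\<bar>fst \<theta>' - fst \<theta>\<bar> \<le> \<rho> k"
      using dist_fst_le[of \<theta>' \<theta>] d by (simp add: dist_real_def)
    have d2: "norm (snd \<theta>' - snd \<theta>) \<le> \<rho> k"
      using dist_snd_le[of \<theta>' \<theta>] d by (simp add: dist_norm)
    have "s' - s u = (fst \<theta>' - fst \<theta>) * fst u + (snd \<theta>' - snd \<theta>) \<bullet> snd u"
      by (simp add: s'_def s_def algebra_simps inner_diff_left)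
    moreover have "\<bar>(fst \<theta>' - fst \<theta>) * fst u\<bar> \<le> \<rho> k * \<bar>fst u\<bar>"
      unfolding abs_mult using d1 by (rule mult_right_mono) simp
    moreover have "\<bar>(snd \<theta>' - snd \<theta>) \<bullet> snd u\<bar> \<le> \<rho> k * norm (snd u)"
      using Cauchy_Schwarz_ineq2[of "snd \<theta>' - snd \<theta>" "snd u"] mult_right_mono[OF d2, of "norm (snd u)"]
      by simp
    ultimately have "\<bar>s' - s u\<bar> \<le> \<rho> k * q u"
      unfolding q_def distrib_left by linarith
    then have "s' \<le> s u + \<rho> k * q u" "exp (s u - \<rho> k * q u) \<le> exp s'" by auto
    then have "frechet_g s' \<le> min (- 1) (s u + \<rho> k * q u - exp (s u - \<rho> k * q u))"
      using frechet_g_le[of s'] unfolding frechet_g_def by (intro min.boundedI) linarith+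
    moreover have "ln (fst \<theta>') \<le> ln (fst \<theta> + \<rho> k)"
      using d1 r' by auto
    ultimately show ?thesis
      unfolding loglik_ratio_def h_def s'_def[symmetric] by linarith
  qed
  \<comment> \<open>A majorant common to all \<open>k\<close>, from \<open>\<rho> k \<le> 1\<close>
    and a minimum that is at most \<open>-1\<close>. Halving the exponent matters here:
    \<open>exp (- frechet_g w)\<close> has infinite integral against \<open>gumbel\<close>.\<close>
  define B where "B u = exp (ln (fst \<theta> + 1) / 2) * exp (- frechet_g (fst u) / 2)"
    for u :: "real \<times> (real ^ 'p)"
  have "integrable (distr ?P gumbel fst) (\<lambda>w. exp (- frechet_g w / 2))"
    unfolding mu.distr_pair_fst by (rule integrable_exp_half_frechet_g)
  then have "integrable ?P (\<lambda>u. exp (- frechet_g (fst u) / 2))"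
    by (subst (asm) integrable_distr_eq) auto
  then have B: "integrable ?P B"
    unfolding B_def by (rule integrable_mult_right)
  have le_B: "exp (h k u / 2) \<le> B u" for k u
  proof -
    have "ln (fst \<theta> + \<rho> k) \<le> ln (fst \<theta> + 1)" using r \<rho>[of k] by simp
    then have "h k u \<le> ln (fst \<theta> + 1) - frechet_g (fst u)"
      unfolding h_def by linarith
    then show ?thesis unfolding B_def by (simp flip: exp_add)
  qed
  have int: "integrable ?P (\<lambda>u. exp (h k u / 2))" for k
    by (rule Bochner_Integration.integrable_bound[OF B]) (use le_B in \<open>auto simp: B_def\<close>)
  have lim: "(\<lambda>k. exp (h k u / 2)) \<longlonglongrightarrow> exp (loglik_ratio \<theta> u / 2)" for u
  proof -
    have "(\<lambda>k. h k u) \<longlonglongrightarrow> ln (fst \<theta> + 0) + min (- 1) (s u + 0 * q u - exp (s u - 0 * q u)) - frechet_g (fst u)"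
      unfolding h_def using r by (intro tendsto_intros \<rho>_lim) auto
    also have "min (- 1) (s u + 0 * q u - exp (s u - 0 * q u)) = frechet_g (s u)"
      using frechet_g_le[of "s u"] by (simp add: frechet_g_def)
    finally have "(\<lambda>k. h k u) \<longlonglongrightarrow> loglik_ratio \<theta> u"
      by (simp add: loglik_ratio_def s_def)
    then show ?thesis by (intro tendsto_intros) auto
  qed
  \<comment> \<open>Shrinking the radius recovers the Hellinger affinity, which is strictly below 1,
    so some positive radius already works.\<close>
  have "(\<lambda>k. \<integral>u. exp (h k u / 2) \<partial>?P) \<longlonglongrightarrow> (\<integral>u. exp (loglik_ratio \<theta> u / 2) \<partial>?P)"
    by (rule integral_dominated_convergence[OF _ _ B]) (use le_B lim in auto)
  then have "eventually (\<lambda>k. (\<integral>u. exp (h k u / 2) \<partial>?P) < 1) sequentially"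
    using integral_exp_half_loglik_ratio_less_1[OF r ne] by (rule order_tendstoD)
  then obtain k where "(\<integral>u. exp (h k u / 2) \<partial>?P) < 1"
    by (auto simp: eventually_sequentially)
  then show ?thesis
    using that[of "\<rho> k" "h k"] \<rho> h_meas envelope int by blast
qed

end

section \<open>Uniform control outside a ball\<close>

text \<open>The events \<open>A n\<close> do not depend on \<open>\<theta>\<close>, so a
  data-dependent candidate may be inserted outcome by outcome.\<close>

lemma (in gumbel_regression) far_candidates_unlikely:
  assumes "prob_space M"
    and indep: "prob_space.indep_vars M (\<lambda>_. borel) U {1..}"
    and law: "\<And>i. i \<ge> 1 \<Longrightarrow> distr M borel (U i) = gumbel \<Otimes>\<^sub>M \<mu>"
    and d: "0 < d" "d < 1"
  obtains A e where "e > 0" "\<And>n. A n \<in> sets M" "(\<lambda>n. measure M (A n)) \<longlonglongrightarrow> 0"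
    "\<And>n \<omega> \<theta>. \<lbrakk>\<omega> \<in> space M; fst \<theta> > 0; dist \<theta> (1, 0) > d;
       (\<Sum>i=1..n. loglik_ratio \<theta> (U i \<omega>)) \<ge> - e * real n\<rbrakk> \<Longrightarrow> \<omega> \<in> A n"
proof -
  interpret prob_space M by fact
  have U [measurable]: "U i \<in> borel_measurable M" if "i \<ge> 1" for i
    using indep that by (auto simp: indep_vars_def)
  let ?S = "sphere (1, 0) d :: (real \<times> (real ^ 'p)) set"
  let ?A = "\<lambda>h e n. {\<omega> \<in> space M. (\<Sum>i=1..n. h (U i \<omega>) / 2) \<ge> - e * real n}"
  \<comment> \<open>The bound \<open>d < 1\<close> keeps the whole sphere inside the half-space of
    positive first coordinates.\<close>
  have sphere_pos: "fst \<theta> > 0" "\<theta> \<noteq> (1, 0)" if "\<theta> \<in> ?S" for \<theta>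
    using that d dist_fst_le[of "(1, 0)" \<theta>] by (auto simp: dist_real_def)
  define Q where "Q \<theta> \<rho> h e \<longleftrightarrow> \<rho> > 0 \<and> e > 0 \<and> h \<in> borel_measurable borel \<and>
      (\<forall>\<theta>' u. dist \<theta>' \<theta> \<le> \<rho> \<longrightarrow> fst \<theta>' > 0 \<longrightarrow> loglik_ratio \<theta>' u \<le> h u) \<and>
      (\<lambda>n. prob (?A h e n)) \<longlonglongrightarrow> 0" for \<theta> \<rho> h e
  have "\<exists>\<rho> h e. Q \<theta> \<rho> h e" if S: "\<theta> \<in> ?S" for \<theta>
  proof -
    obtain \<rho> h where \<rho>: "\<rho> > 0" and "h \<in> borel_measurable (borel \<Otimes>\<^sub>M borel)"
      and h: "\<And>\<theta>' u. dist \<theta>' \<theta> \<le> \<rho> \<Longrightarrow> fst \<theta>' > 0 \<Longrightarrow> loglik_ratio \<theta>' u \<le> h u"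
      and int: "integrable (gumbel \<Otimes>\<^sub>M \<mu>) (\<lambda>u. exp (h u / 2))"
      and less: "(\<integral>u. exp (h u / 2) \<partial>(gumbel \<Otimes>\<^sub>M \<mu>)) < 1"
      using loglik_ratio_local_envelope[OF sphere_pos[OF S]] by metis
    then have [measurable]: "h \<in> borel_measurable borel"
      by (simp add: borel_prod)
    have "\<exists>e>0. (\<lambda>n. prob {\<omega> \<in> space M. (\<Sum>i=1..n. h (U i \<omega>) / 2) \<ge> - e * real n}) \<longlonglongrightarrow> 0"
    proof (rule prob_sum_ge_tendsto_0)
      show "indep_vars (\<lambda>_. borel) (\<lambda>i \<omega>. h (U i \<omega>) / 2) {1..}"
        by (rule indep_vars_compose2[where Y="\<lambda>_ u. h u / 2", OF indep]) measurable
      have distr: "distr M borel (\<lambda>\<omega>. h (U i \<omega>) / 2) = distr (gumbel \<Otimes>\<^sub>M \<mu>) borel (\<lambda>u. h u / 2)"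
        if "i \<ge> 1" for i
        unfolding law[OF that, symmetric] using that by (subst distr_distr) (auto simp: comp_def)
      show "distr M borel (\<lambda>\<omega>. h (U i \<omega>) / 2) = distr M borel (\<lambda>\<omega>. h (U 1 \<omega>) / 2)"
        if "i \<ge> 1" for i
        using that by (simp add: distr)
      show "integrable M (\<lambda>\<omega>. exp (h (U 1 \<omega>) / 2))"
        using int unfolding law[of 1, OF order_refl, symmetric] by (subst (asm) integrable_distr_eq) auto
      show "expectation (\<lambda>\<omega>. exp (h (U 1 \<omega>) / 2)) < 1"
        using less unfolding law[of 1, OF order_refl, symmetric] by (subst (asm) integral_distr) auto
    qed
    then obtain e where "e > 0" "(\<lambda>n. prob (?A h e n)) \<longlonglongrightarrow> 0" by (elim exE conjE) (rule that)
    then have "Q \<theta> \<rho> h e"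
      unfolding Q_def by (intro conjI allI impI \<rho> h \<open>h \<in> borel_measurable borel\<close>)
    then show ?thesis by blast
  qed
  then obtain \<rho> h e where Q: "\<And>\<theta>. \<theta> \<in> ?S \<Longrightarrow> Q \<theta> (\<rho> \<theta>) (h \<theta>) (e \<theta>)"
    by metis
  have \<rho>: "\<rho> \<theta> > 0" and e: "e \<theta> > 0" and h_meas: "h \<theta> \<in> borel_measurable borel"
    and lim: "(\<lambda>n. prob (?A (h \<theta>) (e \<theta>) n)) \<longlonglongrightarrow> 0" if "\<theta> \<in> ?S" for \<theta>
    using Q[OF that] unfolding Q_def by blast+
  have h: "loglik_ratio \<theta>' u \<le> h \<theta> u"
    if "\<theta> \<in> ?S" "dist \<theta>' \<theta> \<le> \<rho> \<theta>" "fst \<theta>' > 0" for \<theta> \<theta>' u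
    using Q[OF that(1)] that(2,3) unfolding Q_def by (elim conjE) iprover
  have "compact ?S" by (rule compact_sphere)
  then obtain C where C: "C \<subseteq> ?S" "finite C" "?S \<subseteq> (\<Union>\<theta>\<in>C. ball \<theta> (\<rho> \<theta>))"
    by (rule compactE_image[of ?S ?S "\<lambda>\<theta>. ball \<theta> (\<rho> \<theta>)"]) (use \<rho> in auto)
  \<comment> \<open>The inserted \<open>1\<close> guarantees a nonempty set for
    \<open>Min\<close>.\<close>
  define e' where "e' = Min (insert 1 (e ` C))"
  have e': "e' > 0" "\<And>\<theta>. \<theta> \<in> C \<Longrightarrow> e' \<le> e \<theta>"
    using C e by (auto simp: e'_def)
  define A where "A n = (\<Union>\<theta>\<in>C. ?A (h \<theta>) (e \<theta>) n)" for n
  have A_meas: "?A (h \<theta>) (e \<theta>) n \<in> sets M" if "\<theta> \<in> C" for \<theta> n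
  proof -
    have [measurable]: "h \<theta> \<in> borel_measurable borel" using that C(1) by (intro h_meas) (rule subsetD)
    show ?thesis by measurable
  qed
  show ?thesis
  proof
    show "e' > 0" by fact
    show "A n \<in> sets M" for n
      unfolding A_def by (intro sets.finite_UN C(2) A_meas)
    have le: "prob (A n) \<le> (\<Sum>\<theta>\<in>C. prob (?A (h \<theta>) (e \<theta>) n))" for n
      unfolding A_def by (intro finite_measure_subadditive_finite C(2) image_subsetI A_meas)
    have "(\<lambda>n. \<Sum>\<theta>\<in>C. prob (?A (h \<theta>) (e \<theta>) n)) \<longlonglongrightarrow> 0"
      by (intro tendsto_null_sum lim subsetD[OF C(1)])
    then show "(\<lambda>n. prob (A n)) \<longlonglongrightarrow> 0"
    proof (rule Lim_null_comparison[rotated], intro always_eventually allI)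
      show "norm (prob (A n)) \<le> (\<Sum>\<theta>\<in>C. prob (?A (h \<theta>) (e \<theta>) n))" for n
        unfolding real_norm_def abs_of_nonneg[OF measure_nonneg] by (rule le)
    qed
    fix n \<omega> \<theta>
    assume \<omega>: "\<omega> \<in> space M" and r: "fst \<theta> > 0" and far: "dist \<theta> (1, 0) > d"
      and sum: "(\<Sum>i=1..n. loglik_ratio \<theta> (U i \<omega>)) \<ge> - e' * real n"
    \<comment> \<open>With this \<open>t\<close> the segment from \<open>(1, 0)\<close> to
      \<open>\<theta>\<close> meets the sphere of radius \<open>d\<close> at
      \<open>\<theta>'\<close>.\<close>
    define t where "t = d / dist \<theta> (1, 0)"
    have D: "dist \<theta> (1, 0) > 0" using d far by linarith
    then have t: "0 < t" "t < 1"
      unfolding t_def using d far by (simp_all only: divide_pos_pos divide_less_eq_1_pos)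
    define \<theta>' where "\<theta>' = (1 - t) *\<^sub>R (1, 0) + t *\<^sub>R \<theta>"
    have "\<theta>' - (1, 0) = t *\<^sub>R (\<theta> - (1, 0))"
      by (simp add: \<theta>'_def algebra_simps)
    then have "dist \<theta>' (1, 0) = t * dist \<theta> (1, 0)"
      using t by (simp add: dist_norm)
    then have \<theta>'_S: "\<theta>' \<in> ?S"
      using D by (simp add: t_def dist_commute)
    from subsetD[OF C(3) this] obtain \<theta>\<^sub>1 where \<theta>\<^sub>1: "\<theta>\<^sub>1 \<in> C" "dist \<theta>\<^sub>1 \<theta>' < \<rho> \<theta>\<^sub>1"
      unfolding UN_iff mem_ball by (rule bexE)
    have "- e \<theta>\<^sub>1 * real n \<le> - e' * real n"
      using e'(2)[OF \<theta>\<^sub>1(1)] by (simp add: mult_right_mono)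
    \<comment> \<open>The bound is nonpositive, so shrinking it by \<open>t \<le> 1\<close> can only
      raise it.\<close>
    also have "\<dots> \<le> t * (- e' * real n)"
      using t e'(1) by (simp add: mult_left_le_one_le)
    also have "\<dots> \<le> t * (\<Sum>i=1..n. loglik_ratio \<theta> (U i \<omega>))"
      using sum t by (intro mult_left_mono) auto
    also have "\<dots> \<le> (\<Sum>i=1..n. h \<theta>\<^sub>1 (U i \<omega>))"
      unfolding sum_distrib_left
    proof (rule sum_mono)
      fix i
      have "t * loglik_ratio \<theta> (U i \<omega>) \<le> loglik_ratio \<theta>' (U i \<omega>)"
        unfolding \<theta>'_def using r t by (intro loglik_ratio_concave) auto
      also have "\<dots> \<le> h \<theta>\<^sub>1 (U i \<omega>)"
        using \<theta>\<^sub>1(2) sphere_pos[OF \<theta>'_S]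
        by (intro h subsetD[OF C(1) \<theta>\<^sub>1(1)]) (simp_all add: dist_commute)
      finally show "t * loglik_ratio \<theta> (U i \<omega>) \<le> h \<theta>\<^sub>1 (U i \<omega>)" .
    qed
    finally have "- e \<theta>\<^sub>1 * real n \<le> (\<Sum>i=1..n. h \<theta>\<^sub>1 (U i \<omega>))" .
    \<comment> \<open>The events \<open>?A\<close> involve \<open>h / 2\<close>; a nonpositive lower
      bound for a sum is also one for half of it.\<close>
    moreover have "- e \<theta>\<^sub>1 * real n \<le> 0"
      using e[OF subsetD[OF C(1) \<theta>\<^sub>1(1)]] by simp
    ultimately have "- e \<theta>\<^sub>1 * real n \<le> (\<Sum>i=1..n. h \<theta>\<^sub>1 (U i \<omega>) / 2)"
      unfolding sum_divide_distrib[symmetric] by linarith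
    then show "\<omega> \<in> A n"
      unfolding A_def using \<omega> by (intro UN_I[OF \<theta>\<^sub>1(1)] CollectI conjI)
  qed
qed

section \<open>Back to the original parameters\<close>

definition reparam :: "real \<times> (real ^ 'p) \<Rightarrow> real \<times> (real ^ 'p) \<Rightarrow> real \<times> (real ^ 'p)" where
  "reparam \<eta>\<^sub>0 \<eta> = (fst \<eta> / fst \<eta>\<^sub>0, fst \<eta> *\<^sub>R (snd \<eta> - snd \<eta>\<^sub>0))"

text \<open>With \<open>w\<close> the standardized error of \<open>(y, x)\<close>, the argument
  \<open>\<alpha> * (\<beta> \<bullet> x - ln y)\<close> becomes
  \<open>r * w + c \<bullet> x\<close>, linear in the new parameter \<open>(r, c)\<close>, and the
  logarithms of the shapes combine to \<open>ln r\<close>.\<close>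

lemma frechet_m_diff:
  assumes "fst \<eta>\<^sub>0 > 0" "fst \<eta> > 0"
  shows "frechet_m \<eta> (y, x) - frechet_m \<eta>\<^sub>0 (y, x) =
    loglik_ratio (reparam \<eta>\<^sub>0 \<eta>) (fst \<eta>\<^sub>0 * (snd \<eta>\<^sub>0 \<bullet> x - ln y), x)"
proof -
  have "fst \<eta> * (snd \<eta> \<bullet> x - ln y) =
      fst \<eta> / fst \<eta>\<^sub>0 * (fst \<eta>\<^sub>0 * (snd \<eta>\<^sub>0 \<bullet> x - ln y)) + (fst \<eta> *\<^sub>R (snd \<eta> - snd \<eta>\<^sub>0)) \<bullet> x"
    using assms by (simp add: inner_diff_left algebra_simps)
  then show ?thesis
    using assms by (simp add: frechet_m_def loglik_ratio_def reparam_def ln_div)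
qed

text \<open>Continuity at \<open>(1, 0)\<close> of the inverse map transfers closeness in the new
  coordinates to the original ones.\<close>

lemma reparam_dist_le:
  fixes \<eta>\<^sub>0 :: "real \<times> (real ^ 'p)"
  assumes a: "fst \<eta>\<^sub>0 > 0" and \<epsilon>: "\<epsilon> > 0"
  obtains d where "0 < d" "d < 1"
    "\<And>\<eta>. fst \<eta> > 0 \<Longrightarrow> dist (reparam \<eta>\<^sub>0 \<eta>) (1, 0) \<le> d \<Longrightarrow> dist \<eta> \<eta>\<^sub>0 \<le> \<epsilon>"
proof -
  define \<sigma> where "\<sigma> \<theta> = (fst \<eta>\<^sub>0 * fst \<theta>, snd \<eta>\<^sub>0 + (1 / (fst \<eta>\<^sub>0 * fst \<theta>)) *\<^sub>R snd \<theta>)"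
    for \<theta> :: "real \<times> (real ^ 'p)"
  have \<sigma>: "\<sigma> (reparam \<eta>\<^sub>0 \<eta>) = \<eta>" if "fst \<eta> > 0" for \<eta>
    using that a by (simp add: \<sigma>_def reparam_def prod_eq_iff)
  have \<sigma>0: "\<sigma> (1, 0) = \<eta>\<^sub>0" by (simp add: \<sigma>_def)
  have "isCont \<sigma> (1, 0)"
    unfolding \<sigma>_def[abs_def] using a by (intro continuous_intros) auto
  then obtain d where d: "d > 0" "\<And>\<theta>. dist \<theta> (1, 0) < d \<Longrightarrow> dist (\<sigma> \<theta>) \<eta>\<^sub>0 < \<epsilon>"
    using \<epsilon> unfolding continuous_at_eps_delta \<sigma>0 by blast
  show ?thesis
  \<comment> \<open>Halving \<open>d\<close> turns the strict inequality of continuity into a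
    non-strict one; the cap \<open>1 / 2\<close> secures a radius below 1.\<close>
  proof (rule that[of "min (d / 2) (1 / 2)"])
    fix \<eta> :: "real \<times> (real ^ 'p)"
    assume "fst \<eta> > 0" "dist (reparam \<eta>\<^sub>0 \<eta>) (1, 0) \<le> min (d / 2) (1 / 2)"
    then have "dist (\<sigma> (reparam \<eta>\<^sub>0 \<eta>)) \<eta>\<^sub>0 < \<epsilon>" using d by (intro d(2)) auto
    then show "dist \<eta> \<eta>\<^sub>0 \<le> \<epsilon>" using \<open>fst \<eta> > 0\<close> by (simp add: \<sigma>)
  qed (use d in auto)
qed

section \<open>Consistency of near-maximizers\<close>

theorem theorem4p1:
  fixes M :: "'w measure"
    and Y :: "nat \<Rightarrow> 'w \<Rightarrow> real"
    and X :: "nat \<Rightarrow> 'w \<Rightarrow> real ^ 'p"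
    and Z :: "nat \<Rightarrow> 'w \<Rightarrow> real \<times> (real ^ 'p)"
    and \<eta>\<^sub>0 :: "real \<times> (real ^ 'p)"
    and \<eta> :: "nat \<Rightarrow> 'w \<Rightarrow> real \<times> (real ^ 'p)"
    and R :: "nat \<Rightarrow> 'w \<Rightarrow> real"
  defines "Z \<equiv> (\<lambda>i \<omega>. (Y i \<omega>, X i \<omega>))"
  assumes "prob_space M"
    and indep: "prob_space.indep_vars M (\<lambda>_. borel) Z {1..}"
    and ident: "\<And>i. i \<ge> 1 \<Longrightarrow> distr M borel (Z i) = distr M borel (Z 1)"
    and pos: "\<And>i \<omega>. i \<ge> 1 \<Longrightarrow> \<omega> \<in> space M \<Longrightarrow> Y i \<omega> > 0"
    and true_param: "\<eta>\<^sub>0 \<in> frechet_params"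
    and model: "\<And>i. i \<ge> 1 \<Longrightarrow> frechet_model M \<eta>\<^sub>0 (Y i) (X i)"
    and nondegenerate:
      "\<And>a :: real ^ 'p. a \<noteq> 0 \<Longrightarrow> measure M {\<omega> \<in> space M. a \<bullet> X 1 \<omega> = 0} < 1"
    and estimator: "\<And>n. n \<ge> 1 \<Longrightarrow> estimator_from M Z n (\<eta> n)"
    and estimator_H: "\<And>n \<omega>. n \<ge> 1 \<Longrightarrow> \<omega> \<in> space M \<Longrightarrow> \<eta> n \<omega> \<in> frechet_params"
    and R_measurable: "\<And>n. n \<ge> 1 \<Longrightarrow> R n \<in> borel_measurable M"
    and R_small: "tendsto_in_prob M R 0"
    and near_max: "\<And>n \<omega>. n \<ge> 1 \<Longrightarrow> \<omega> \<in> space M \<Longrightarrow>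
      frechet_M Z n (\<eta> n \<omega>) \<omega> \<ge> frechet_M Z n \<eta>\<^sub>0 \<omega> - R n \<omega>"
  shows "tendsto_in_prob M \<eta> \<eta>\<^sub>0"
proof -
  interpret prob_space M by fact
  obtain a b where \<eta>\<^sub>0: "\<eta>\<^sub>0 = (a, b)" by force
  have a: "a > 0" using true_param by (simp add: \<eta>\<^sub>0 frechet_params_def)
  have Z: "Z i \<in> borel_measurable M" if "i \<ge> 1" for i
    using indep that by (auto simp: indep_vars_def)
  have Y [measurable]: "Y i \<in> borel_measurable M" and X [measurable]: "X i \<in> borel_measurable M"
    if "i \<ge> 1" for i
    using measurable_compose[OF Z[OF that], of fst borel] measurable_compose[OF Z[OF that], of snd borel]
    by (auto simp: Z_def borel_prod[symmetric])
  define S where "S = (\<lambda>(y, x :: real ^ 'p). (a * (b \<bullet> x - ln y), x))"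
  have S [measurable]: "S \<in> borel_measurable borel"
    unfolding S_def borel_prod[symmetric] by measurable
  define \<mu> where "\<mu> = distr M borel (X 1)"
  interpret gumbel_regression \<mu>
  proof (intro gumbel_regression.intro gumbel_regression_axioms.intro)
    show "prob_space \<mu>" unfolding \<mu>_def by (rule prob_space_distr) (rule X, simp)
    show "sets \<mu> = sets borel" by (simp add: \<mu>_def)
    fix c :: "real ^ 'p" assume "c \<noteq> 0"
    have "measure \<mu> {x. c \<bullet> x = 0} = measure M {\<omega> \<in> space M. c \<bullet> X 1 \<omega> = 0}"
      unfolding \<mu>_def by (subst measure_distr) (auto intro!: arg_cong[where f=prob])
    then show "measure \<mu> {x. c \<bullet> x = 0} < 1" using nondegenerate[OF \<open>c \<noteq> 0\<close>] by simp
  qed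
  \<comment> \<open>These are the standardized observations; being images of the \<open>Z i\<close>
    under one fixed map, they inherit independence and a common law.\<close>
  define U where "U i \<omega> = S (Z i \<omega>)" for i \<omega>
  have U_indep: "indep_vars (\<lambda>_. borel) U {1..}"
    unfolding U_def by (rule indep_vars_compose2[where Y="\<lambda>_. S", OF indep]) (rule S)
  have U_law: "distr M borel (U i) = gumbel \<Otimes>\<^sub>M \<mu>" if i: "i \<ge> 1" for i
  proof -
    have "distr M borel (U i) = distr (distr M borel (Z i)) borel S"
      unfolding U_def by (subst distr_distr[OF S Z[OF i]]) (simp add: comp_def)
    also have "\<dots> = distr M borel (U 1)"
      unfolding U_def ident[OF i] by (subst distr_distr[OF S Z]) (simp_all add: comp_def)
    also have "\<dots> = gumbel \<Otimes>\<^sub>M \<mu>"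
      using frechet_model_gumbel[OF \<open>prob_space M\<close> Y X _ a, of 1 1 b] model[of 1]
      by (simp add: U_def[abs_def] S_def Z_def \<mu>_def \<eta>\<^sub>0)
    finally show ?thesis .
  qed
  have sum_eq: "(\<Sum>i=1..n. loglik_ratio (reparam \<eta>\<^sub>0 \<eta>') (U i \<omega>)) =
      real n * (frechet_M Z n \<eta>' \<omega> - frechet_M Z n \<eta>\<^sub>0 \<omega>)"
    if "n \<ge> 1" "fst \<eta>' > 0" for n \<eta>' \<omega>
    using that frechet_m_diff[of \<eta>\<^sub>0 \<eta>'] a
    by (simp add: frechet_M_def U_def S_def Z_def \<eta>\<^sub>0 right_diff_distrib flip: sum_subtractf)
  show ?thesis
    unfolding tendsto_in_prob_def
  proof (intro allI impI)
    fix \<epsilon> :: real assume "\<epsilon> > 0"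
    then obtain d where d: "0 < d" "d < 1"
      and close: "\<And>\<eta>. fst \<eta> > 0 \<Longrightarrow> dist (reparam \<eta>\<^sub>0 \<eta>) (1, 0) \<le> d \<Longrightarrow> dist \<eta> \<eta>\<^sub>0 \<le> \<epsilon>"
      using reparam_dist_le[of \<eta>\<^sub>0 \<epsilon>] a unfolding \<eta>\<^sub>0 fst_conv by metis
    obtain A e where e: "e > 0" and A [measurable]: "\<And>n. A n \<in> sets M"
      and A_lim: "(\<lambda>n. prob (A n)) \<longlonglongrightarrow> 0"
      and A_far: "\<And>n \<omega> \<theta>. \<lbrakk>\<omega> \<in> space M; fst \<theta> > 0; dist \<theta> (1, 0) > d;
         (\<Sum>i=1..n. loglik_ratio \<theta> (U i \<omega>)) \<ge> - e * real n\<rbrakk> \<Longrightarrow> \<omega> \<in> A n"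
      using far_candidates_unlikely[OF \<open>prob_space M\<close> U_indep U_law d] by metis
    let ?B = "\<lambda>n. {\<omega> \<in> space M. dist (R n \<omega>) 0 > e}"
    have bound: "prob {\<omega> \<in> space M. dist (\<eta> n \<omega>) \<eta>\<^sub>0 > \<epsilon>} \<le> prob (?B n) + prob (A n)" if n: "n \<ge> 1" for n
    proof -
      have [measurable]: "R n \<in> borel_measurable M" using n by (rule R_measurable)
      \<comment> \<open>If the estimate is far and \<open>A n\<close> fails, its objective value
        falls short of that of the truth by more than \<open>e\<close>, which near-maximality
        permits only when \<open>R n\<close> exceeds \<open>e\<close>.\<close>
      have "{\<omega> \<in> space M. dist (\<eta> n \<omega>) \<eta>\<^sub>0 > \<epsilon>} \<subseteq> ?B n \<union> A n"
      proof safe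
        fix \<omega> assume \<omega>: "\<omega> \<in> space M" and far: "dist (\<eta> n \<omega>) \<eta>\<^sub>0 > \<epsilon>" and "\<omega> \<notin> A n"
        have pos: "fst (\<eta> n \<omega>) > 0"
          using estimator_H[OF n \<omega>] by (auto simp: frechet_params_def)
        have "fst (reparam \<eta>\<^sub>0 (\<eta> n \<omega>)) > 0"
          using pos a by (simp add: reparam_def \<eta>\<^sub>0)
        moreover have "dist (reparam \<eta>\<^sub>0 (\<eta> n \<omega>)) (1, 0) > d"
          using close[OF pos] far by force
        ultimately have "\<not> (\<Sum>i=1..n. loglik_ratio (reparam \<eta>\<^sub>0 (\<eta> n \<omega>)) (U i \<omega>)) \<ge> - e * real n"
          using A_far[OF \<omega>] \<open>\<omega> \<notin> A n\<close> by blast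
        then have "real n * (frechet_M Z n (\<eta> n \<omega>) \<omega> - frechet_M Z n \<eta>\<^sub>0 \<omega>) < real n * (- e)"
          unfolding sum_eq[OF n pos] not_le by (simp add: mult.commute)
        then have "frechet_M Z n (\<eta> n \<omega>) \<omega> - frechet_M Z n \<eta>\<^sub>0 \<omega> < - e"
          using n by (subst (asm) mult_less_cancel_left_pos) auto
        then show "dist (R n \<omega>) 0 > e"
          using near_max[OF n \<omega>] by (simp add: dist_real_def)
      qed
      then have "prob {\<omega> \<in> space M. dist (\<eta> n \<omega>) \<eta>\<^sub>0 > \<epsilon>} \<le> prob (?B n \<union> A n)"
        by (rule finite_measure_mono) measurable
      also have "\<dots> \<le> prob (?B n) + prob (A n)"
        by (rule measure_Un_le) measurable
      finally show ?thesis .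
    qed
    have "(\<lambda>n. prob (?B n)) \<longlonglongrightarrow> 0"
      using R_small e unfolding tendsto_in_prob_def by blast
    then have "(\<lambda>n. prob (?B n) + prob (A n)) \<longlonglongrightarrow> 0"
      using A_lim by (rule tendsto_add_zero)
    \<comment> \<open>The comparison starts at \<open>n = 1\<close>, since the hypotheses on the
      estimators and on \<open>R n\<close> do.\<close>
    then show "(\<lambda>n. prob {\<omega> \<in> space M. dist (\<eta> n \<omega>) \<eta>\<^sub>0 > \<epsilon>}) \<longlonglongrightarrow> 0"
    proof (rule Lim_null_comparison[rotated], intro eventually_sequentiallyI[of 1])
      show "norm (prob {\<omega> \<in> space M. dist (\<eta> n \<omega>) \<eta>\<^sub>0 > \<epsilon>}) \<le> prob (?B n) + prob (A n)" if "n \<ge> 1" for n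
        unfolding real_norm_def abs_of_nonneg[OF measure_nonneg] by (rule bound[OF that])
    qed
  qed
qed

end
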